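(* Define $$\alpha := 2\prod_{j=1}^{\infty}\left[\frac{s_{j+1}}{(s_j-1)^2}\right]^{2^{j-1}}$$ (a convergent product, $\alpha\doteq 5.522868$), where $(s_j)_{j\ge 0}$ is Sylvester's sequence. For each integer $n\geq 2$, let $m'_n$ be the positive integer defined in the context (the conjectural index of the Esser--Totaro--Wang klt Calabi--Yau variety of dimension $n$). Then $$m'_n\geq \frac{(s_n -1)(2s_{n}-3)}{9\alpha/8}$$ if $n$ is even and $$m'_n\geq \frac{(s_n -1)(2s_{n}-3)}{6\alpha^2/7}$$ if $n$ is odd.
   Context: Sylvester's sequence: $s_0=2$, $s_{j+1}=s_j(s_j-1)+1$. Alternating sums: given integers $b_i$, write $$B_{i_1\cdots i_k} := b_{i_1}\cdots b_{i_k}-b_{i_1}\cdots b_{i_{k-1}}+\cdots+(-1)^{k-1}b_{i_1}+(-1)^k,$$ with $B=1$ for the empty subscript. Empty products are $1$. Let $n=2r+1$ or $n=2r$ with $r\ge 1$. For $0\le i\le r$ let $b_i:=s_i$. For $1\le i\le r$ define inductively $$b_{r+i} := 1+(b_{r+1-i}-1)^2B_{r+1,r,r+2,r-1,\ldots,r-1+i,r+2-i},$$ where the subscript list is the concatenation of the pairs $(r+j,\,r+1-j)$ for $j=1,\ldots,i-1$ (empty for $i=1$). Subscript lists below: "$r+1,r,\ldots,2r,1$" is the concatenation of the pairs $(r+j,r+1-j)$ for $j=1,\ldots,r$; "$r+1,r,\ldots,2r-1,2$" is the same for $j=1,\ldots,r-1$ (empty if $r=1$); "$1,2r,\ldots,r,r+1$"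 is the concatenation of the pairs $(j,2r+1-j)$ for $j=1,\ldots,r$; "$2,2r-1,\ldots,r,r+1$" is the same for $j=2,\ldots,r$ (empty if $r=1$). Define the integers $$b'_{2r+1} := \tfrac{1}{2}\left(1 + b_1 \cdots b_{2r} + (s_1-1)B_{r+1,r,\ldots,2r,1}\right),$$ $$b'_{2r} := \tfrac{1}{3}\left(1 + 2(s_1-1)^2 b_2 \cdots b_{2r-1} + 2(s_2-1)B_{r+1,r,\ldots,2r-1,2}\right),$$ $$m'_{2r+1} := b_0b'_{2r+1}B_{1,2r,\ldots,r,r+1} - b_0 + 1,\qquad m'_{2r} := b_1 b'_{2r} B_{2,2r-1,\ldots,r,r+1} - b_1 + 1.$$ *)

theory Defs
  imports "HOL-Analysis.Analysis"
begin

fun sylvester :: "nat \<Rightarrow> int" where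
  "sylvester 0 = 2"
| "sylvester (Suc j) = sylvester j * (sylvester j - 1) + 1"

(* The argument lists the values b_{i_1}, ..., b_{i_k}, not the subscripts. *)
definition alt_sum :: "int list \<Rightarrow> int" where
  "alt_sum xs = (\<Sum>t\<le>length xs. (-1) ^ (length xs - t) * prod_list (take t xs))"

(* r+1, r, r+2, r-1, ..., r+k, r+1-k; only used for k <= r, so the subtraction is not truncated *)
definition outward_indices :: "nat \<Rightarrow> nat \<Rightarrow> nat list" where
  "outward_indices r k = concat (map (\<lambda>j. [r + j, r + 1 - j]) [1..<k + 1])"

(* k, 2r+1-k, k+1, 2r-k, ..., r, r+1 *)
definition inward_indices :: "nat \<Rightarrow> nat \<Rightarrow> nat list" where
  "inward_indices r k = concat (map (\<lambda>j. [j, 2 * r + 1 - j]) [k..<r + 1])"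

(* bseq r k is b_k for the given r. In the second branch k = r + i with 1 <= i <= r, so that
   i - 1 = k - r - 1 and r + 1 - i = 2r + 1 - k. The value 0 beyond index 2r is a dummy. *)
function bseq :: "nat \<Rightarrow> nat \<Rightarrow> int" where
  "bseq r k =
     (if k \<le> r then sylvester k
      else if k \<le> 2 * r then
        1 + (bseq r (2 * r + 1 - k) - 1)\<^sup>2
            * alt_sum (map (bseq r) (outward_indices r (k - r - 1)))
      else 0)"
  by pat_completeness auto
termination
  by (relation "Wellfounded.measure snd") (auto simp: outward_indices_def)

declare bseq.simps [simp del]

definition altB :: "nat \<Rightarrow> nat list \<Rightarrow> int" where
  "altB r is = alt_sum (map (bseq r) is)"

lemma bseq_initial: "i \<le> r \<Longrightarrow> bseq r i = sylvester i"
  by (simp add: bseq.simps)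

lemma bseq_step:
  assumes "1 \<le> i" "i \<le> r"
  shows "bseq r (r + i) = 1 + (bseq r (r + 1 - i) - 1)\<^sup>2 * altB r (outward_indices r (i - 1))"
proof -
  have "2 * r + 1 - (r + i) = r + 1 - i" by simp
  then show ?thesis
    using assms by (subst bseq.simps) (simp add: altB_def)
qed

(* b'_{2r+1} and b'_{2r}, taken in the reals: the divisions by 2 and 3 are exact quotients,
   never rounded. *)
definition bprime_odd :: "nat \<Rightarrow> real" where
  "bprime_odd r =
     of_int (1 + (\<Prod>i=1..2*r. bseq r i)
               + (sylvester 1 - 1) * altB r (outward_indices r r)) / 2"

definition bprime_even :: "nat \<Rightarrow> real" where
  "bprime_even r =
     of_int (1 + 2 * (sylvester 1 - 1)\<^sup>2 * (\<Prod>i=2..2*r-1. bseq r i)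
               + 2 * (sylvester 2 - 1) * altB r (outward_indices r (r - 1))) / 3"

definition mprime :: "nat \<Rightarrow> real" where
  "mprime n =
     (let r = n div 2 in
      if odd n
      then of_int (bseq r 0) * bprime_odd r * of_int (altB r (inward_indices r 1))
             - of_int (bseq r 0) + 1
      else of_int (bseq r 1) * bprime_even r * of_int (altB r (inward_indices r 2))
             - of_int (bseq r 1) + 1)"

(* The factor with index j >= 1 in the usual numbering is alpha_factor (j - 1). *)
definition alpha_factor :: "nat \<Rightarrow> real" where
  "alpha_factor k =
     (of_int (sylvester (k + 2)) / (of_int (sylvester (k + 1)) - 1)\<^sup>2) ^ (2 ^ k)"

definition alpha :: real where
  "alpha = 2 * (\<Prod>k. alpha_factor k)"

(* prodinf is only meaningful for convergent products, so convergence is established here. *)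

lemma sylvester_lower: "(2::int) ^ (2 ^ k) \<le> sylvester (k + 1) - 1"
proof (induction k)
  case 0
  then show ?case by simp
next
  case (Suc k)
  let ?t = "sylvester (k + 1) - 1"
  have "(2::int) ^ (2 ^ Suc k) = (2 ^ (2 ^ k))\<^sup>2"
    by (simp flip: power_mult add: mult.commute)
  also have "\<dots> \<le> ?t\<^sup>2"
    by (rule power_mono[OF Suc]) simp
  also have "\<dots> \<le> ?t * (?t + 1)"
    using Suc by (simp add: power2_eq_square algebra_simps)
      (smt (verit) one_le_power zero_less_power)
  also have "\<dots> = sylvester (Suc k + 1) - 1"
    by (simp add: algebra_simps)
  finally show ?case .
qed

lemma alpha_factor_bounds: "1 \<le> alpha_factor k" "alpha_factor k - 1 \<le> 8 * (1 / 2) ^ k"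
proof -
  define t :: real where "t = of_int (sylvester (k + 1)) - 1"
  define N :: nat where "N = 2 ^ k"
  have "real_of_int (2 ^ N) \<le> of_int (sylvester (k + 1) - 1)"
    unfolding N_def of_int_le_iff by (rule sylvester_lower)
  then have t: "2 ^ N \<le> t" by (simp add: t_def)
  have N: "1 \<le> N" "k < N" by (simp_all add: N_def)
  have "(2::real) ^ 1 \<le> 2 ^ N" using N by (intro power_increasing) auto
  then have t2: "2 \<le> t" using t by simp
  have s: "of_int (sylvester (k + 2)) = t\<^sup>2 + t + 1"
    by (simp add: t_def power2_eq_square algebra_simps)
  define x where "x = (t + 1) / t\<^sup>2"
  have x0: "0 \<le> x" using t2 by (simp add: x_def)
  have af: "alpha_factor k = (1 + x) ^ N"
    using t2 unfolding alpha_factor_def s x_def N_def t_def[symmetric] by (simp add: field_simps)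
  show "1 \<le> alpha_factor k" using x0 by (simp add: af one_le_power)
  have "x \<le> 2 * t / t\<^sup>2" unfolding x_def using t2 by (intro divide_right_mono) auto
  also have "\<dots> = 2 / t" using t2 by (simp add: power2_eq_square)
  also have "\<dots> \<le> 2 / 2 ^ N" using t by (intro divide_left_mono) (use t2 in auto)
  finally have x: "x \<le> 2 / 2 ^ N" .
  define y where "y = real N * x"
  have y0: "0 \<le> y" using x0 by (simp add: y_def)
  have yb: "y \<le> 2 * real N / 2 ^ N"
    using mult_left_mono[OF x, of "real N"] by (simp add: y_def mult.commute)
  have "N \<le> 2 ^ (N - 1)"
    using less_exp[of "N - 1"] N by linarith
  then have N1: "2 * N \<le> 2 ^ N"
    using N by (cases N) auto
  have "2 * real N \<le> 2 ^ N" using N1 by (metis of_nat_le_iff of_nat_mult of_nat_numeral of_nat_power)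
  then have y1: "y \<le> 1" using yb by (smt (verit) divide_le_eq_1_pos zero_less_power)
  have "2 * k \<le> N + 1"
  proof (cases k)
    case (Suc m)
    have "m < 2 ^ m" by (rule less_exp)
    moreover have "N = 2 * 2 ^ m" using Suc by (simp add: N_def)
    ultimately show ?thesis using Suc by linarith
  qed simp
  then have "(2::real) ^ (2 * k) \<le> 2 ^ (N + 1)" by (rule power_increasing) simp
  then have NN: "real N * 2 ^ k \<le> 2 * 2 ^ N"
    by (simp add: N_def power_mult power2_eq_square power_mult_distrib[symmetric])
  have "1 + x \<le> exp x" by (rule exp_ge_add_one_self)
  then have "(1 + x) ^ N \<le> exp x ^ N" using x0 by (intro power_mono) auto
  also have "\<dots> = exp y" by (simp add: y_def exp_of_nat_mult)
  also have "\<dots> \<le> 1 + y + y\<^sup>2" by (rule exp_bound[OF y0 y1])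
  also have "\<dots> \<le> 1 + 2 * y" using y0 y1 by (simp add: power2_eq_square mult_left_le)
  finally have "alpha_factor k - 1 \<le> 2 * y" by (simp add: af)
  also have "\<dots> \<le> 4 * real N / 2 ^ N" using yb by simp
  also have "\<dots> \<le> 8 * (1 / 2) ^ k" using NN by (simp add: field_simps)
  finally show "alpha_factor k - 1 \<le> 8 * (1 / 2) ^ k" .
qed

lemma convergent_prod_alpha_factor: "convergent_prod alpha_factor"
proof -
  have "summable (\<lambda>k. 8 * (1 / 2 :: real) ^ k)"
    by (intro summable_mult summable_geometric) simp
  then have "summable (\<lambda>k. \<bar>alpha_factor k - 1\<bar>)"
    by (rule summable_comparison_test'[where N = 0])
      (use alpha_factor_bounds in \<open>simp add: abs_of_nonneg\<close>)
  then have "convergent_prod (\<lambda>k. 1 + (alpha_factor k - 1))"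
    by (rule summable_imp_convergent_prod_real)
      (use alpha_factor_bounds(1) in \<open>smt (verit)\<close>)
  then show ?thesis by simp
qed

end

theory Submission
  imports Defs
begin

text \<open>
  Write $t_j = s_j - 1$, so that $t_{j+1} = t_j s_j$. In terms of $t$ the numerator of the claimed
  bound is $t_n (2 t_n - 1) < 2 t_n^2$, and so $m'_n$ only has to be compared with $t_n^2$. All
  quantities in $m'_n$ are governed by the products
  $Q_m = b_m b_{m+1} \cdots b_{2r+1-m}$ (\<^const>\<open>bseq\<close> values, symmetric about the middle).
  An alternating sum of positive integers satisfies
  $y \, B_{\ldots,y} \ge (y-1) \cdot (\hbox{product of the entries})$, because the part that is
  subtracted is again at most the product of the earlier entries. Applied to the outward sums in $b'_{2r+1}$
  and $b'_{2r}$, which end in $b_1 = 3$ and $b_2 = 7$, this gives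
  $m'_{2r+1} \ge \frac{7}{3} Q_1 B$ (\<open>mprime_odd_lower\<close>), and
  $m'_{2r} \ge \frac{128}{7} Q_2 B$ for $r \ge 2$ (\<open>mprime_even_lower\<close>), where $B$
  is the inward alternating sum. As that sum ends in $b_{r+1} = 1 + t_r^2$, it also gives
  $(1 + t_r^{-2}) B \ge Q_1$, respectively $\ge Q_2$.

  To compare $Q_m$ with $t_n$, let
  $W_m = \prod_{j=m}^{r} (s_{j+1}/t_j^2)^{2^{j-m}}$. Here $2 W_1$ is a
  partial product of $\alpha$, whose factors are all at least $1$, so $\alpha \ge 2 W_1$; and
  $W_m = (s_{m+1}/t_m^2) W_{m+1}^2$ for $m < r$, so $2 W_1 = \frac{7}{2} W_2^2$ for $r \ge 2$. The definition of
  $b_{2r+1-m}$ and the same bound on alternating sums, now for the sum ending in $b_{m+1}$,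
  show that $R_m = Q_m W_m t_m$ satisfies the clean recursion $R_m \ge R_{m+1}^2$
  (\<open>R_step\<close>), in which the powers of $t$ have all cancelled. It starts
  at $R_r = t_{r+2} (1 + t_r^{-2})$, whence $R_m \ge (t_{r+2} (1 + t_r^{-2}))^{2^{r-m}}$.
  On the other hand $t_n \le (t_{r+2} + 1)^{2^{r-m}}$ for $n = 2r + 2 - m$. The
  surplus factor $1 + t_r^{-2}$ is much larger than $1 + t_{r+2}^{-1}$: it absorbs the difference
  between $t_{r+2}$ and $t_{r+2} + 1$, and one more factor $1 + t_r^{-2}$ is left over to pay for
  the bound on $B$ (\<open>t_le_R\<close>, \<open>t_sq_le_midprod\<close>). The odd case uses $m = 1$, the even
  case $m = 2$. Since $m \le r$ is needed, $n = 2$ is computed separately.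
\<close>

section \<open>Alternating sums\<close>

lemma alt_sum_Nil [simp]: "alt_sum [] = 1"
  by (simp add: alt_sum_def)

lemma alt_sum_snoc: "alt_sum (xs @ [y]) = prod_list xs * y - alt_sum xs"
proof -
  have "(\<Sum>t\<le>length xs. (-1) ^ (Suc (length xs) - t) * prod_list (take t (xs @ [y])))
      = (\<Sum>t\<le>length xs. - ((-1) ^ (length xs - t) * prod_list (take t xs)))"
    by (rule sum.cong) (auto simp: Suc_diff_le)
  then show ?thesis
    by (simp add: alt_sum_def sum_negf)
qed

lemma prod_list_ge_1:
  fixes xs :: "int list"
  assumes "\<And>x. x \<in> set xs \<Longrightarrow> 1 \<le> x"
  shows "1 \<le> prod_list xs"
  using assms
proof (induction xs)
  case (Cons x xs)
  then have "1 \<le> x" "1 \<le> prod_list xs"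
    by auto
  then have "1 * 1 \<le> x * prod_list xs"
    by (intro mult_mono) auto
  then show ?case by simp
qed simp

lemma alt_sum_bounds:
  assumes "\<And>x. x \<in> set xs \<Longrightarrow> 1 \<le> x"
  shows "0 \<le> alt_sum xs \<and> alt_sum xs \<le> prod_list xs"
  using assms
proof (induction xs rule: rev_induct)
  case (snoc y xs)
  have "1 \<le> prod_list xs" "1 \<le> y"
    using snoc.prems by (auto intro: prod_list_ge_1)
  then have "prod_list xs * 1 \<le> prod_list xs * y"
    by (intro mult_left_mono) auto
  moreover have "0 \<le> alt_sum xs \<and> alt_sum xs \<le> prod_list xs"
    using snoc by simp
  ultimately show ?case
    by (auto simp: alt_sum_snoc)
qed simp

text \<open>Bounding an alternating sum with last entry $y$ from below by the product of its entries
  costs only the factor $(y-1)/y$. All lower bounds for alternating sums below are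
  instances.\<close>

lemma alt_sum_snoc_lower:
  assumes "\<And>x. x \<in> set (xs @ [y]) \<Longrightarrow> 1 \<le> x"
  shows "(y - 1) * prod_list (xs @ [y]) \<le> y * alt_sum (xs @ [y])"
proof -
  have "alt_sum xs \<le> prod_list xs" "1 \<le> y"
    using alt_sum_bounds[of xs] assms by auto
  then have "y * (prod_list xs * y - prod_list xs) \<le> y * (prod_list xs * y - alt_sum xs)"
    by (intro mult_left_mono) auto
  then show ?thesis
    by (simp add: alt_sum_snoc algebra_simps)
qed

section \<open>The numbers $b_i$\<close>

lemma outward_indices_0 [simp]: "outward_indices r 0 = []"
  by (simp add: outward_indices_def)

lemma outward_indices_Suc:
  "outward_indices r (Suc k) = outward_indices r k @ [r + Suc k, r - k]"
  by (simp add: outward_indices_def)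

lemma set_outward_indices: "k \<le> r \<Longrightarrow> set (outward_indices r k) \<subseteq> {..r + k}"
  by (induction k) (auto simp: outward_indices_Suc)

lemma inward_indices_last:
  assumes "k \<le> r"
  shows "\<exists>is. inward_indices r k = is @ [r + 1]"
proof -
  have "[k..<r + 1] = [k..<r] @ [r]"
    using assms by simp
  then show ?thesis
    by (simp add: inward_indices_def)
qed

lemma set_inward_indices: "1 \<le> k \<Longrightarrow> set (inward_indices r k) \<subseteq> {..2 * r}"
  by (auto simp: inward_indices_def)

lemma sylvester_ge_2: "2 \<le> sylvester j"
proof (induction j)
  case (Suc j)
  then have "2 * 1 \<le> sylvester j * (sylvester j - 1)"
    by (intro mult_mono) auto
  then show ?case by simp
qed simp

lemma bseq_ge_1: "k \<le> 2 * r \<Longrightarrow> 1 \<le> bseq r k"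
proof (induction k rule: less_induct)
  case (less k)
  show ?case
  proof (cases "k \<le> r")
    case True
    then show ?thesis
      using sylvester_ge_2[of k] by (simp add: bseq_initial)
  next
    case False
    then have "set (outward_indices r (k - r - 1)) \<subseteq> {..<k}"
      using set_outward_indices[of "k - r - 1" r] less.prems by fastforce
    then have "0 \<le> alt_sum (map (bseq r) (outward_indices r (k - r - 1)))"
      using less by (intro alt_sum_bounds[THEN conjunct1]) auto
    then show ?thesis
      using False less.prems by (subst bseq.simps) auto
  qed
qed

text \<open>The product of the consecutive values symmetric about the middle of the index range:
  $b_m b_{m+1} \cdots b_{2r+1-m}$.\<close>

definition midprod :: "nat \<Rightarrow> nat \<Rightarrow> int" where
  "midprod r m = (\<Prod>i=m..2 * r + 1 - m. bseq r i)"

lemma midprod_peel: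
  assumes "1 \<le> m" "m \<le> r"
  shows "midprod r m = bseq r m * bseq r (2 * r + 1 - m) * midprod r (Suc m)"
proof -
  have "2 * r + 1 - m = Suc (2 * r - m)" "m \<le> 2 * r - m" "2 * r + 1 - Suc m = 2 * r - m"
    using assms by auto
  then show ?thesis
    by (simp add: midprod_def prod.atLeast_Suc_atMost mult_ac)
qed

lemma midprod_middle: "midprod r (Suc r) = 1"
  by (simp add: midprod_def)

lemma midprod_ge_1: "1 \<le> m \<Longrightarrow> 1 \<le> midprod r m"
  unfolding midprod_def using bseq_ge_1[of _ r] by (intro prod_ge_1) auto

lemma prod_list_outward:
  "k \<le> r \<Longrightarrow> prod_list (map (bseq r) (outward_indices r k)) = midprod r (r + 1 - k)"
proof (induction k)
  case (Suc k)
  then have eq: "2 * r + 1 - (r - k) = r + Suc k" "Suc (r - k) = r + 1 - k"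
    by auto
  have "midprod r (r - k) = bseq r (r - k) * bseq r (r + Suc k) * midprod r (r + 1 - k)"
    using midprod_peel[of "r - k" r] Suc.prems unfolding eq by simp
  then show ?case
    using Suc by (simp add: outward_indices_Suc mult_ac)
qed (simp add: midprod_middle)

lemma prod_list_inward:
  assumes "1 \<le> k" "k \<le> r + 1"
  shows "prod_list (map (bseq r) (inward_indices r k)) = midprod r k"
  using assms(2,1)
proof (induction k rule: inc_induct)
  case base
  then show ?case by (simp add: inward_indices_def midprod_middle)
next
  case (step k)
  have "[k..<r + 1] = k # [Suc k..<r + 1]"
    using step by (simp add: upt_conv_Cons)
  then have "inward_indices r k = [k, 2 * r + 1 - k] @ inward_indices r (Suc k)"
    by (simp add: inward_indices_def)
  then show ?case
    using step by (simp add: midprod_peel mult_ac)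
qed

text \<open>The outward list consisting of $r+1-m$ pairs ends in the index $m$, and $b_m = s_m$.\<close>

lemma altB_outward_lower:
  assumes "1 \<le> m" "m \<le> r"
  shows "(sylvester m - 1) * midprod r m \<le> sylvester m * altB r (outward_indices r (r + 1 - m))"
proof -
  let ?l = "map (bseq r) (outward_indices r (r + 1 - m))"
  have "outward_indices r (r + 1 - m)
      = (outward_indices r (r - m) @ [r + Suc (r - m)]) @ [m]"
    using assms outward_indices_Suc[of r "r - m"] by (simp add: Suc_diff_le)
  then have l: "?l = map (bseq r) (outward_indices r (r - m) @ [r + Suc (r - m)]) @ [sylvester m]"
    using assms by (simp add: bseq_initial)
  have "set (outward_indices r (r + 1 - m)) \<subseteq> {..2 * r}"
    using set_outward_indices[of "r + 1 - m" r] assms by fastforce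
  then have "\<And>x. x \<in> set ?l \<Longrightarrow> 1 \<le> x"
    by (auto intro: bseq_ge_1)
  then have "(sylvester m - 1) * prod_list ?l \<le> sylvester m * alt_sum ?l"
    unfolding l by (rule alt_sum_snoc_lower)
  moreover have "prod_list ?l = midprod r m"
    using assms by (subst prod_list_outward) auto
  ultimately show ?thesis
    by (simp add: altB_def)
qed

lemma altB_inward_lower:
  assumes "1 \<le> k" "k \<le> r"
  shows "(bseq r (r + 1) - 1) * midprod r k \<le> bseq r (r + 1) * altB r (inward_indices r k)"
proof -
  obtain "is" where "is": "inward_indices r k = is @ [r + 1]"
    using inward_indices_last assms by blast
  let ?l = "map (bseq r) (inward_indices r k)"
  have l: "?l = map (bseq r) is @ [bseq r (r + 1)]"
    by (simp add: "is")
  have "\<And>x. x \<in> set ?l \<Longrightarrow> 1 \<le> x"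
    using set_inward_indices[OF assms(1), of r] by (auto intro: bseq_ge_1)
  then have "(bseq r (r + 1) - 1) * prod_list ?l \<le> bseq r (r + 1) * alt_sum ?l"
    unfolding l by (rule alt_sum_snoc_lower)
  moreover have "prod_list ?l = midprod r k"
    using assms by (intro prod_list_inward) auto
  ultimately show ?thesis
    by (simp add: altB_def)
qed

lemma bseq_Suc_middle: "1 \<le> r \<Longrightarrow> bseq r (r + 1) = 1 + (sylvester r - 1)\<^sup>2"
  using bseq_step[of 1 r] by (simp add: altB_def bseq_initial)

section \<open>The recursion $R_m \ge R_{m+1}^2$\<close>

text \<open>The predecessor $t_j = s_j - 1 = s_0 \cdots s_{j-1}$, as a real number.\<close>

definition t :: "nat \<Rightarrow> real" where
  "t j = of_int (sylvester j) - 1"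

lemma of_int_sylvester: "of_int (sylvester j) = t j + 1"
  by (simp add: t_def)

lemma t_Suc: "t (Suc j) = t j * (t j + 1)"
  by (simp add: t_def algebra_simps)

lemma t_pos: "0 < t j"
  using sylvester_ge_2[of j] by (simp add: t_def)

lemma t_ge_2: "1 \<le> j \<Longrightarrow> 2 \<le> t j"
proof (induction j rule: dec_induct)
  case (step j)
  then have "2 * 1 \<le> t j * (t j + 1)" by (intro mult_mono) auto
  then show ?case by (simp add: t_Suc)
qed (simp add: t_def)

text \<open>The part from index $m$ to index $r$ of the product defining $\alpha$, with the exponents
  normalised so that the first one is $1$. The index $j$ is the usual one, so that the $j$-th factor
  is the base of \<^term>\<open>alpha_factor (j - 1)\<close>.\<close>

definition W :: "nat \<Rightarrow> nat \<Rightarrow> real" where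
  "W r m = (\<Prod>j=m..r. ((t (Suc j) + 1) / (t j)\<^sup>2) ^ 2 ^ (j - m))"

lemma W_pos: "0 < W r m"
  unfolding W_def using t_pos
  by (intro prod_pos ballI zero_less_power divide_pos_pos add_pos_pos) auto

lemma W_self: "W r r = (t (Suc r) + 1) / (t r)\<^sup>2"
  by (simp add: W_def)

lemma W_rec:
  assumes "m < r"
  shows "W r m = (t (Suc m) + 1) / (t m)\<^sup>2 * (W r (Suc m))\<^sup>2"
proof -
  let ?A = "\<lambda>j. (t (Suc j) + 1) / (t j)\<^sup>2"
  have "(\<Prod>j=Suc m..r. ?A j ^ 2 ^ (j - m)) = (\<Prod>j=Suc m..r. (?A j ^ 2 ^ (j - Suc m))\<^sup>2)"
  proof (rule prod.cong)
    fix j assume "j \<in> {Suc m..r}"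
    then have "j - m = Suc (j - Suc m)" by auto
    then have "(2::nat) ^ (j - m) = 2 ^ (j - Suc m) * 2" by simp
    then show "?A j ^ 2 ^ (j - m) = (?A j ^ 2 ^ (j - Suc m))\<^sup>2"
      by (simp only: power_mult)
  qed simp
  then show ?thesis
    using assms unfolding W_def
    by (subst prod.atLeast_Suc_atMost) (simp_all only: prod_power_distrib, simp_all)
qed

lemma alpha_ge_W: "2 * W r 1 \<le> alpha"
proof -
  have "W r 1 = (\<Prod>k<r. alpha_factor k)"
    unfolding W_def alpha_factor_def
    by (rule prod.reindex_bij_witness[of _ Suc "\<lambda>j. j - 1"])
      (auto simp: of_int_sylvester simp del: sylvester.simps)
  also have "\<dots> \<le> prodinf alpha_factor"
    using convergent_prod_has_prod[OF convergent_prod_alpha_factor] alpha_factor_bounds(1)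
    by (intro prod_le_prodinf) (auto intro: order_trans[OF zero_le_one])
  finally show ?thesis
    by (simp add: alpha_def)
qed

text \<open>The product $b_m \cdots b_{2r+1-m}$, weighted so that it satisfies $R_m \ge R_{m+1}^2$ without
  any further factor.\<close>

definition R :: "nat \<Rightarrow> nat \<Rightarrow> real" where
  "R r m = of_int (midprod r m) * W r m * t m"

lemma R_self:
  assumes "1 \<le> r"
  shows "R r r = t (r + 2) * (1 + 1 / (t r)\<^sup>2)"
proof -
  have "real_of_int (midprod r r) = (t r + 1) * (1 + (t r)\<^sup>2)"
    using assms midprod_peel[of r r]
    by (simp add: midprod_middle bseq_initial bseq_Suc_middle[simplified] of_int_sylvester)
  then show ?thesis
    using t_pos[of r] by (simp add: R_def W_self t_Suc field_simps power2_eq_square)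
qed

text \<open>The two losses are the summand $1$ in the definition of $b_{2r+1-m}$ and the factor
  $t_{m+1}/s_{m+1}$ in the bound for the alternating sum; the remaining powers of $t$ combine by
  $t_{m+1} = t_m s_m$.\<close>

lemma R_step:
  assumes "1 \<le> m" "m < r"
  shows "(R r (Suc m))\<^sup>2 \<le> R r m"
proof -
  let ?P = "real_of_int (midprod r (Suc m))"
  let ?B = "real_of_int (altB r (outward_indices r (r - m)))"
  let ?C = "(t (Suc m) + 1) / (t m)\<^sup>2 * (W r (Suc m))\<^sup>2"
  have tp: "0 < t m" "0 < t (Suc m)" by (simp_all add: t_pos)
  have P: "0 < ?P" using midprod_ge_1[of "Suc m" r] by simp
  \<comment> \<open>The defining equation of $b_{r+i}$ for $i = r + 1 - m$, where $r + i = 2r + 1 - m$.\<close>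
  have "bseq r (r + (r + 1 - m)) = 1 + (bseq r (r + 1 - (r + 1 - m)) - 1)\<^sup>2
      * altB r (outward_indices r (r + 1 - m - 1))"
    using assms by (intro bseq_step) auto
  then have "bseq r (2 * r + 1 - m) = 1 + (sylvester m - 1)\<^sup>2 * altB r (outward_indices r (r - m))"
    using assms by (simp add: bseq_initial mult_2)
  then have "real_of_int (bseq r (2 * r + 1 - m)) = 1 + (t m)\<^sup>2 * ?B"
    by (simp add: of_int_sylvester)
  then have Q: "real_of_int (midprod r m) = (t m + 1) * (1 + (t m)\<^sup>2 * ?B) * ?P"
    using assms by (simp add: midprod_peel bseq_initial of_int_sylvester)
  have "real_of_int ((sylvester (Suc m) - 1) * midprod r (Suc m))
      \<le> real_of_int (sylvester (Suc m) * altB r (outward_indices r (r - m)))"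
    using altB_outward_lower[of "Suc m" r] assms unfolding of_int_le_iff by simp
  then have B: "t (Suc m) * ?P \<le> (t (Suc m) + 1) * ?B"
    by (simp add: of_int_sylvester del: sylvester.simps)
  have "(R r (Suc m))\<^sup>2 = t (Suc m) * ?P * (t (Suc m) * ?P * (W r (Suc m))\<^sup>2)"
    by (simp add: R_def power2_eq_square)
  also have "\<dots> \<le> (t (Suc m) + 1) * ?B * (t (Suc m) * ?P * (W r (Suc m))\<^sup>2)"
    using B P tp by (intro mult_right_mono) auto
  also have "\<dots> = (t m + 1) * ((t m)\<^sup>2 * ?B) * ?P * (?C * t m)"
    using tp by (simp add: t_Suc[of m] field_simps power2_eq_square)
  also have "\<dots> \<le> (t m + 1) * (1 + (t m)\<^sup>2 * ?B) * ?P * (?C * t m)"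
    using P tp by (intro mult_right_mono mult_left_mono) auto
  also have "\<dots> = R r m"
    using assms by (simp add: R_def Q W_rec)
  finally show ?thesis .
qed

lemma R_lower:
  assumes "1 \<le> m" "m \<le> r"
  shows "(t (r + 2) * (1 + 1 / (t r)\<^sup>2)) ^ 2 ^ (r - m) \<le> R r m"
  using assms(2,1)
proof (induction m rule: inc_induct)
  case base
  then show ?case by (simp add: R_self)
next
  case (step m)
  let ?X = "t (r + 2) * (1 + 1 / (t r)\<^sup>2)"
  have "(2::nat) ^ (r - m) = 2 ^ (r - Suc m) * 2"
    using step by (metis Suc_diff_Suc power_Suc2)
  then have "?X ^ 2 ^ (r - m) = (?X ^ 2 ^ (r - Suc m))\<^sup>2"
    by (simp only: power_mult)
  also have "\<dots> \<le> (R r (Suc m))\<^sup>2"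
    using step t_pos[of "r + 2"] by (intro power_mono) auto
  also have "\<dots> \<le> R r m"
    using step by (intro R_step) auto
  finally show ?case .
qed

lemma t_upper: "t (j + k) \<le> (t j + 1) ^ 2 ^ k"
proof -
  have "t (j + k) + 1 \<le> (t j + 1) ^ 2 ^ k"
  proof (induction k)
    case (Suc k)
    have "t (j + Suc k) + 1 \<le> (t (j + k) + 1)\<^sup>2"
      using t_pos[of "j + k"] by (simp add: t_Suc power2_eq_square algebra_simps)
    also have "\<dots> \<le> ((t j + 1) ^ 2 ^ k)\<^sup>2"
      using Suc t_pos[of "j + k"] by (intro power_mono) auto
    also have "\<dots> = (t j + 1) ^ 2 ^ Suc k"
      by (simp only: power_mult[symmetric] power_Suc2)
    finally show ?case .
  qed simp
  then show ?thesis by simp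
qed

text \<open>Put $z = 1 + t_r^{-2}$, $y = 1/t_{r+2}$ and $N = 2^{r-m}$. As $t_{r+2} \ge 3 t_r^2$, one has
  $(1+y)^2 \le z$, and so $z (1+y)^{2N} \le z^{N+1} \le z^{2N}$.\<close>

lemma t_le_R:
  assumes "1 \<le> m" "m \<le> r"
  shows "(1 + 1 / (t r)\<^sup>2) * (t (2 * r + 2 - m))\<^sup>2 \<le> (R r m)\<^sup>2"
proof -
  let ?N = "2 ^ (r - m) :: nat"
  let ?y = "1 / t (r + 2)" and ?z = "1 + 1 / (t r)\<^sup>2"
  have tp: "2 \<le> t r" using assms by (intro t_ge_2) auto
  have z: "1 \<le> ?z" by simp
  have T: "0 < t (r + 2)" by (rule t_pos)
  have t2: "t (r + 2) = (t r)\<^sup>2 * (t r + 1) * (t r + 1 + 1 / t r)"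
    using tp by (simp add: t_Suc field_simps power2_eq_square)
  have "(t r)\<^sup>2 * 3 * 1 \<le> (t r)\<^sup>2 * (t r + 1) * (t r + 1 + 1 / t r)"
    using tp by (intro mult_mono) auto
  then have a: "3 * (t r)\<^sup>2 \<le> t (r + 2)"
    unfolding t2 by simp
  have b: "1 \<le> t (r + 2)" using t_ge_2[of "r + 2"] by simp
  have "(1 + ?y)\<^sup>2 = 1 + 2 * ?y + ?y * ?y"
    by (simp add: power2_eq_square algebra_simps)
  also have "\<dots> \<le> 1 + 2 * ?y + ?y * 1"
    using b by (intro add_left_mono mult_left_mono) auto
  also have "\<dots> = 1 + 3 / t (r + 2)" by simp
  also have "\<dots> \<le> 1 + 3 / (3 * (t r)\<^sup>2)"
    using a tp T by (intro add_left_mono divide_left_mono mult_pos_pos) auto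
  finally have z2: "(1 + ?y)\<^sup>2 \<le> ?z" by simp
  have "2 * r + 2 - m = r + 2 + (r - m)" using assms by simp
  then have "t (2 * r + 2 - m) \<le> (t (r + 2) + 1) ^ ?N"
    using t_upper[of "r + 2" "r - m"] by (simp only:)
  then have "?z * (t (2 * r + 2 - m))\<^sup>2 \<le> ?z * ((t (r + 2) + 1) ^ ?N)\<^sup>2"
    using t_pos[of "2 * r + 2 - m", THEN less_imp_le] z
    by (intro mult_left_mono power_mono) linarith+
  also have "t (r + 2) + 1 = t (r + 2) * (1 + ?y)"
    using T by (simp add: field_simps)
  also have "?z * ((t (r + 2) * (1 + ?y)) ^ ?N)\<^sup>2
      = (t (r + 2) ^ ?N)\<^sup>2 * (?z * ((1 + ?y)\<^sup>2) ^ ?N)"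
    by (simp add: power_mult_distrib mult_ac flip: power_mult)
  also have "\<dots> \<le> (t (r + 2) ^ ?N)\<^sup>2 * (?z ^ ?N * ?z ^ ?N)"
    using z z2 by (intro mult_left_mono mult_mono power_mono self_le_power) auto
  also have "\<dots> = ((t (r + 2) * ?z) ^ ?N)\<^sup>2"
    by (simp only: power2_eq_square power_mult_distrib mult_ac)
  also have "\<dots> \<le> (R r m)\<^sup>2"
    using R_lower[OF assms] T by (intro power_mono) auto
  finally show ?thesis .
qed

section \<open>Comparison of $m'_n$ with $t_n^2$\<close>

lemma altB_inward_ge:
  assumes "1 \<le> k" "k \<le> r"
  shows "of_int (midprod r k) \<le> (1 + 1 / (t r)\<^sup>2) * of_int (altB r (inward_indices r k))"
    and "1 \<le> altB r (inward_indices r k)"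
proof -
  let ?P = "real_of_int (midprod r k)" and ?B = "real_of_int (altB r (inward_indices r k))"
  have P: "1 \<le> ?P" using midprod_ge_1 assms(1) by simp
  have b: "real_of_int (bseq r (r + 1)) = 1 + (t r)\<^sup>2"
    using assms by (subst bseq_Suc_middle) (auto simp: of_int_sylvester)
  have "real_of_int ((bseq r (r + 1) - 1) * midprod r k)
      \<le> real_of_int (bseq r (r + 1) * altB r (inward_indices r k))"
    using altB_inward_lower[OF assms] unfolding of_int_le_iff .
  then have B: "(t r)\<^sup>2 * ?P \<le> (1 + (t r)\<^sup>2) * ?B"
    by (simp only: of_int_mult of_int_diff of_int_1 b) simp
  then show "?P \<le> (1 + 1 / (t r)\<^sup>2) * ?B"
    using t_pos[of r] by (simp add: field_simps)
  have "0 < (t r)\<^sup>2 * ?P" using P t_pos[of r] by simp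
  then have "0 < (1 + (t r)\<^sup>2) * ?B" using B by linarith
  then have "0 < ?B"
    using zero_le_power2[of "t r"] by (smt (verit) zero_less_mult_iff)
  then show "1 \<le> altB r (inward_indices r k)" by simp
qed

lemma alpha_pos: "0 < alpha"
  using alpha_ge_W[of 1] W_pos[of 1 1] by linarith

text \<open>One factor $1 + t_r^{-2}$ is gained in \<open>t_le_R\<close> and lost in \<open>altB_inward_ge\<close>.\<close>

lemma t_sq_le_midprod:
  assumes "1 \<le> m" "m \<le> r"
  shows "(t (2 * r + 2 - m))\<^sup>2
      \<le> (W r m * t m)\<^sup>2 * (of_int (midprod r m) * of_int (altB r (inward_indices r m)))"
proof -
  let ?P = "real_of_int (midprod r m)" and ?B = "real_of_int (altB r (inward_indices r m))"
  let ?z = "1 + 1 / (t r)\<^sup>2" and ?d = "W r m * t m"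
  have "1 \<le> ?P" using midprod_ge_1[OF assms(1)] by simp
  have z: "1 \<le> ?z" by simp
  have "?z * (t (2 * r + 2 - m))\<^sup>2 \<le> (R r m)\<^sup>2"
    by (rule t_le_R[OF assms])
  also have "\<dots> = ?d\<^sup>2 * ?P * ?P" by (simp add: R_def power2_eq_square)
  also have "\<dots> \<le> ?d\<^sup>2 * ?P * (?z * ?B)"
    using altB_inward_ge(1)[OF assms] \<open>1 \<le> ?P\<close> by (intro mult_left_mono) auto
  also have "\<dots> = ?z * (?d\<^sup>2 * (?P * ?B))" by (simp only: mult_ac)
  finally show ?thesis using z by simp
qed

lemma t_Suc_0 [simp]: "t (Suc 0) = 2"
  by (simp add: t_def)

lemma t_2 [simp]: "t 2 = 6"
  by (simp add: t_def numeral_2_eq_2)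

text \<open>The numerator of the bound is $t_n (2 t_n - 1)$; only the leading term matters.\<close>

lemma rhs_le:
  assumes "0 < c"
  shows "(of_int (sylvester n) - 1) * (2 * of_int (sylvester n) - 3) / c \<le> 2 * (t n)\<^sup>2 / c"
proof -
  have "(of_int (sylvester n) - 1) * (2 * of_int (sylvester n) - 3) = t n * (2 * t n - 1)"
    by (simp add: of_int_sylvester algebra_simps)
  also have "\<dots> \<le> 2 * (t n)\<^sup>2"
    using t_pos[of n] by (simp add: power2_eq_square algebra_simps)
  finally show ?thesis
    using assms by (intro divide_right_mono) auto
qed

lemma mprime_odd_lower:
  assumes "1 \<le> r"
  shows "7 / 3 * (of_int (midprod r 1) * of_int (altB r (inward_indices r 1))) \<le> mprime (2 * r + 1)"
proof -
  let ?P = "real_of_int (midprod r 1)" and ?B = "real_of_int (altB r (inward_indices r 1))"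
  let ?C = "real_of_int (altB r (outward_indices r r))"
  have B: "1 \<le> ?B" using altB_inward_ge(2)[of 1 r] assms by simp
  have "real_of_int (2 * midprod r 1) \<le> real_of_int (3 * altB r (outward_indices r r))"
    using altB_outward_lower[of 1 r] assms unfolding of_int_le_iff by simp
  then have C: "2 * ?P \<le> 3 * ?C" by simp
  have m: "mprime (2 * r + 1) = (1 + ?P + 2 * ?C) * ?B - 1"
    by (simp add: mprime_def bprime_odd_def midprod_def bseq_initial)
  have "7 / 3 * (?P * ?B) \<le> (1 + 7 / 3 * ?P) * ?B - 1"
    using B by (simp add: algebra_simps)
  also have "\<dots> \<le> mprime (2 * r + 1)"
    unfolding m using B C by (intro diff_right_mono mult_right_mono) auto
  finally show ?thesis .
qed

lemma mprime_even_lower: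
  assumes "2 \<le> r"
  shows "128 / 7 * (of_int (midprod r 2) * of_int (altB r (inward_indices r 2))) \<le> mprime (2 * r)"
proof -
  let ?P = "real_of_int (midprod r 2)" and ?B = "real_of_int (altB r (inward_indices r 2))"
  let ?C = "real_of_int (altB r (outward_indices r (r - 1)))"
  have s: "sylvester 1 = 3" "sylvester 2 = 7" by (simp_all add: numeral_2_eq_2)
  \<comment> \<open>The summand $-2$ in $m'_{2r}$ has to be absorbed by $B$, so the bound $B \ge 1$ is not enough here.\<close>
  have "0 < bseq r (2 * r + 1 - 2) * midprod r (Suc 2)"
    using midprod_ge_1[of "Suc 2" r] bseq_ge_1[of "2 * r + 1 - 2" r] by simp
  then have "7 \<le> midprod r 2"
    using midprod_peel[of 2 r] assms s by (simp add: bseq_initial)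
  then have P: "7 \<le> ?P" by simp
  have "1 / (t r)\<^sup>2 \<le> 1"
    using t_ge_2[of r] assms by (simp add: one_le_power)
  then have "(1 + 1 / (t r)\<^sup>2) * ?B \<le> 2 * ?B"
    using altB_inward_ge(2)[of 2 r] assms by (intro mult_right_mono) auto
  then have B: "2 \<le> ?B"
    using altB_inward_ge(1)[of 2 r] assms P by linarith
  have "real_of_int (6 * midprod r 2) \<le> real_of_int (7 * altB r (outward_indices r (r - 1)))"
    using altB_outward_lower[of 2 r] assms unfolding of_int_le_iff s
    by (simp add: numeral_2_eq_2 Suc_diff_Suc)
  then have C: "6 * ?P \<le> 7 * ?C" by simp
  have m: "mprime (2 * r) = (1 + 8 * ?P + 12 * ?C) * ?B - 2"
    using assms s by (simp add: mprime_def bprime_even_def midprod_def bseq_initial Let_def)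
  have "128 / 7 * (?P * ?B) \<le> (1 + 8 * ?P + 12 * (6 / 7 * ?P)) * ?B - 2"
    using B by (simp add: algebra_simps)
  also have "\<dots> \<le> mprime (2 * r)"
    unfolding m using B C by (intro diff_right_mono mult_right_mono) auto
  finally show ?thesis .
qed

theorem lemma8p2:
  fixes n :: nat
  assumes "n \<ge> 2"
  shows "(even n \<longrightarrow>
            mprime n \<ge> (of_int (sylvester n) - 1) * (2 * of_int (sylvester n) - 3) / (9 * alpha / 8))
       \<and> (odd n \<longrightarrow>
            mprime n \<ge> (of_int (sylvester n) - 1) * (2 * of_int (sylvester n) - 3) / (6 * alpha\<^sup>2 / 7))"
proof (intro conjI impI)
  assume "odd n"
  then obtain r where n: "n = 2 * r + 1" by (rule oddE)
  with assms have r: "1 \<le> r" by simp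
  let ?PB = "real_of_int (midprod r 1) * of_int (altB r (inward_indices r 1))"
  have PB: "0 \<le> ?PB"
    using midprod_ge_1[of 1 r] altB_inward_ge(2)[of 1 r] r by simp
  have "(t n)\<^sup>2 \<le> (W r 1 * t 1)\<^sup>2 * ?PB"
    using t_sq_le_midprod[of 1 r] r by (simp add: n)
  also have "\<dots> = (2 * W r 1)\<^sup>2 * ?PB" by simp
  also have "\<dots> \<le> alpha\<^sup>2 * ?PB"
    using alpha_ge_W[of r] W_pos[of r 1] PB by (intro mult_right_mono power_mono) auto
  finally have "2 * (t n)\<^sup>2 / (6 * alpha\<^sup>2 / 7) \<le> 7 / 3 * ?PB"
    using alpha_pos by (simp add: field_simps)
  also have "\<dots> \<le> mprime n"
    using mprime_odd_lower[OF r] by (simp add: n)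
  finally show "mprime n \<ge>
      (of_int (sylvester n) - 1) * (2 * of_int (sylvester n) - 3) / (6 * alpha\<^sup>2 / 7)"
    using rhs_le[of "6 * alpha\<^sup>2 / 7" n] alpha_pos by simp
next
  assume "even n"
  then obtain r where n: "n = 2 * r" by (rule evenE)
  have "(of_int (sylvester n) - 1) * (2 * of_int (sylvester n) - 3) / (9 * alpha / 8) \<le> mprime n"
  proof (cases "r = 1")
    case True
    \<comment> \<open>Here $m'_2 = 19$ and the numerator is $66$, so the first factor of $\alpha$ is enough.\<close>
    have "W 1 1 = 7 / 4"
      unfolding W_self by (simp add: t_2[unfolded numeral_2_eq_2])
    then have "7 / 2 \<le> alpha"
      using alpha_ge_W[of 1] by linarith
    moreover have "mprime n = 19"
      by (simp add: n True mprime_def bprime_even_def bseq_initial altB_def inward_indices_def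
          bseq_Suc_middle[of 1, simplified] alt_sum_def numeral_2_eq_2)
    moreover have "sylvester n = 7"
      by (simp add: n True numeral_2_eq_2)
    ultimately show ?thesis
      by (simp add: field_simps)
  next
    case False
    with assms n have r: "2 \<le> r" by simp
    let ?PB = "real_of_int (midprod r 2) * of_int (altB r (inward_indices r 2))"
    have PB: "0 \<le> ?PB"
      using midprod_ge_1[of 2 r] altB_inward_ge(2)[of 2 r] r by simp
    have "W r 1 = 7 / 4 * (W r 2)\<^sup>2"
      using W_rec[of 1 r] r t_2 by (simp add: numeral_2_eq_2)
    then have "(W r 2)\<^sup>2 \<le> 2 / 7 * alpha"
      using alpha_ge_W[of r] by simp
    then have "36 * (W r 2)\<^sup>2 * ?PB \<le> 36 * (2 / 7 * alpha) * ?PB"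
      using PB by (intro mult_right_mono mult_left_mono) auto
    moreover have "(t n)\<^sup>2 \<le> 36 * (W r 2)\<^sup>2 * ?PB"
      using t_sq_le_midprod[of 2 r] r by (simp add: n power_mult_distrib mult_ac)
    ultimately have "(t n)\<^sup>2 \<le> 36 * (2 / 7 * alpha) * ?PB" by linarith
    then have "2 * (t n)\<^sup>2 / (9 * alpha / 8) \<le> 128 / 7 * ?PB"
      using alpha_pos by (simp add: field_simps)
    also have "\<dots> \<le> mprime n"
      using mprime_even_lower[OF r] by (simp add: n)
    finally show ?thesis
      using rhs_le[of "9 * alpha / 8" n] alpha_pos by simp
  qed
  then show "mprime n \<ge>
      (of_int (sylvester n) - 1) * (2 * of_int (sylvester n) - 3) / (9 * alpha / 8)" .
qed

end
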